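(* Let $f:\mathbb{R}^n\to\mathbb{R}^n$ be a $C^1$ vector field with flow $\phi_t$, let $X\subseteq\mathbb{R}^n$ be a compact forward invariant set, and suppose that $\dot x=f(x)$ is nonexpansive on $X$ with respect to a norm $\|\cdot\|$ on $\mathbb{R}^n$. Let $\mathbb{A}=\bigcap_{t\ge0}\phi_t(X)$. Then for every $x\in X$ the omega limit set $\omega(x)$ is contained in $\mathbb{A}$.
   Context: $\phi_t$ denotes the forward time evolution of $\dot x=f(x)$, assumed to be defined for all $t\ge0$. The system is nonexpansive on $X$ if $\|\phi_t(x)-\phi_t(y)\|\le\|x-y\|$ for all $x,y\in X$ and $t>0$. The omega limit set of $x$ is $\omega(x)=\bigcap_{t\ge0}\overline{\bigcup_{s\ge t}\{\phi_s(x)\}}$. The set $\mathbb{A}$ is called the global attractor of the system relative to $X$. *)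

theory Defs
  imports "HOL-Analysis.Analysis"
begin

definition is_norm :: "('a::real_vector \<Rightarrow> real) \<Rightarrow> bool" where
  "is_norm N \<longleftrightarrow>
     (\<forall>x. 0 \<le> N x) \<and>
     (\<forall>x. N x = 0 \<longleftrightarrow> x = 0) \<and>
     (\<forall>c x. N (c *\<^sub>R x) = \<bar>c\<bar> * N x) \<and>
     (\<forall>x y. N (x + y) \<le> N x + N y)"

definition C1_vector_field :: "('a::euclidean_space \<Rightarrow> 'a) \<Rightarrow> bool" where
  "C1_vector_field f \<longleftrightarrow>
     (\<exists>f' :: 'a \<Rightarrow> 'a \<Rightarrow>\<^sub>L 'a.
        (\<forall>x. (f has_derivative blinfun_apply (f' x)) (at x)) \<and> continuous_on UNIV f')"

text \<open>
  The curve \<open>t \<mapsto> \<phi> t x\<close> solves \<open>x' = f x\<close> on all of \<open>[0, \<infinity>)\<close> from the initial value \<open>x\<close>;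
  at time 0 the derivative is one-sided. Values of \<open>\<phi>\<close> at negative times are unconstrained.
\<close>
definition forward_flow ::
    "('a::euclidean_space \<Rightarrow> 'a) \<Rightarrow> (real \<Rightarrow> 'a \<Rightarrow> 'a) \<Rightarrow> bool" where
  "forward_flow f \<phi> \<longleftrightarrow>
     (\<forall>x. \<phi> 0 x = x \<and>
        (\<forall>t\<ge>0. ((\<lambda>s. \<phi> s x) has_vector_derivative f (\<phi> t x)) (at t within {0..})))"

definition forward_invariant :: "(real \<Rightarrow> 'a \<Rightarrow> 'a) \<Rightarrow> 'a set \<Rightarrow> bool" where
  "forward_invariant \<phi> X \<longleftrightarrow> (\<forall>t\<ge>0. \<phi> t ` X \<subseteq> X)"

definition nonexpansive_on ::
    "('a::real_vector \<Rightarrow> real) \<Rightarrow> (real \<Rightarrow> 'a \<Rightarrow> 'a) \<Rightarrow> 'a set \<Rightarrow> bool" where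
  "nonexpansive_on N \<phi> X \<longleftrightarrow>
     (\<forall>x\<in>X. \<forall>y\<in>X. \<forall>t>0. N (\<phi> t x - \<phi> t y) \<le> N (x - y))"

text \<open>
  The closure is taken in the Euclidean topology, which is also the topology of any other norm
  on a finite-dimensional space.
\<close>
definition omega_limit :: "(real \<Rightarrow> 'a::euclidean_space \<Rightarrow> 'a) \<Rightarrow> 'a \<Rightarrow> 'a set" where
  "omega_limit \<phi> x = (\<Inter>t\<in>{0..}. closure (\<Union>s\<in>{t..}. {\<phi> s x}))"

definition global_attractor :: "(real \<Rightarrow> 'a \<Rightarrow> 'a) \<Rightarrow> 'a set \<Rightarrow> 'a set" where
  "global_attractor \<phi> X = (\<Inter>t\<in>{0..}. \<phi> t ` X)"

end

theory Submission
  imports Defs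
begin

text \<open>
  Two solutions that stay in the compact set \<open>X\<close> separate at most exponentially, because \<open>f\<close> is
  Lipschitz on \<open>X\<close> (\<open>C1_vector_field_lipschitz_on_compact\<close>, \<open>solutions_separate_exponentially\<close>).
  This estimate has two consequences. Solutions in \<open>X\<close> are determined by their initial value, so
  \<open>\<phi> s x = \<phi> t (\<phi> (s - t) x)\<close> for \<open>s \<ge> t \<ge> 0\<close>; with forward invariance, the part of the
  orbit of \<open>x\<close> after time \<open>t\<close> lies in \<open>\<phi> t ` X\<close>. Moreover \<open>\<phi> t\<close> is continuous on \<open>X\<close>, so that
  \<open>\<phi> t ` X\<close> is compact, hence closed, and contains the closure of that part of the orbit as well.
  Intersecting over all \<open>t \<ge> 0\<close> gives the inclusion of the omega limit set in the attractor.
\<close>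

text \<open>
  The mean value inequality needs a convex domain, which \<open>X\<close> need not be; it is applied on a
  closed ball containing \<open>X\<close>, where the continuous derivative is bounded.
\<close>
lemma C1_vector_field_lipschitz_on_compact:
  assumes "C1_vector_field f" and "compact X"
  obtains L where "\<And>x y. x \<in> X \<Longrightarrow> y \<in> X \<Longrightarrow> norm (f x - f y) \<le> L * norm (x - y)"
proof -
  obtain f' where f': "\<And>x. (f has_derivative blinfun_apply (f' x)) (at x)"
    and cont: "continuous_on UNIV f'"
    using assms(1) unfolding C1_vector_field_def by blast
  obtain c r where r: "X \<subseteq> cball c r"
    using compact_imp_bounded[OF assms(2)] unfolding bounded_subset_cball by blast
  have "compact (f' ` cball c r)"
    by (rule compact_continuous_image[OF continuous_on_subset[OF cont subset_UNIV] compact_cball])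
  then obtain L where L: "\<And>x. x \<in> cball c r \<Longrightarrow> norm (f' x) \<le> L"
    using compact_imp_bounded[of "f' ` cball c r"] unfolding bounded_iff ball_simps by blast
  show thesis
  proof (rule that)
    fix x y assume "x \<in> X" "y \<in> X"
    then show "norm (f x - f y) \<le> L * norm (x - y)"
      using r L by (intro differentiable_bound[of "cball c r" f "\<lambda>x. blinfun_apply (f' x)"])
        (auto intro: has_derivative_at_withinI[OF f'] simp flip: norm_blinfun.rep_eq)
  qed
qed

text \<open>
  Gronwall's inequality in the form needed here: by Cauchy-Schwarz, the squared distance \<open>d\<close> of the
  two curves satisfies \<open>d' \<le> 2 * L * d\<close>, so \<open>exp (- 2 * L * s) * d s\<close> is nonincreasing.
\<close>
lemma solutions_separate_exponentially:
  fixes u v :: "real \<Rightarrow> 'a::real_inner"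
  assumes lip: "\<And>x y. x \<in> X \<Longrightarrow> y \<in> X \<Longrightarrow> norm (f x - f y) \<le> L * norm (x - y)"
    and u: "\<And>s. s \<ge> 0 \<Longrightarrow> (u has_vector_derivative f (u s)) (at s within {0..})"
    and v: "\<And>s. s \<ge> 0 \<Longrightarrow> (v has_vector_derivative f (v s)) (at s within {0..})"
    and uX: "\<And>s. s \<ge> 0 \<Longrightarrow> u s \<in> X" and vX: "\<And>s. s \<ge> 0 \<Longrightarrow> v s \<in> X"
    and "t \<ge> 0"
  shows "norm (u t - v t) \<le> exp (L * t) * norm (u 0 - v 0)"
proof -
  define g where "g s = exp (- 2 * L * s) * ((u s - v s) \<bullet> (u s - v s))" for s
  define g' where "g' s = exp (- 2 * L * s) *
      (2 * ((u s - v s) \<bullet> (f (u s) - f (v s))) - 2 * L * ((u s - v s) \<bullet> (u s - v s)))" for s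
  have deriv: "(g has_real_derivative g' s) (at s within {0..})" if "s \<ge> 0" for s
    unfolding g_def g'_def has_real_derivative_iff_has_vector_derivative
    using u[OF that] v[OF that] unfolding has_vector_derivative_def
    by (auto intro!: derivative_eq_intros simp: algebra_simps inner_commute)
  have g'_nonpos: "g' s \<le> 0" if "s \<ge> 0" for s
  proof -
    have "(u s - v s) \<bullet> (f (u s) - f (v s)) \<le> norm (u s - v s) * norm (f (u s) - f (v s))"
      by (rule norm_cauchy_schwarz)
    also have "\<dots> \<le> norm (u s - v s) * (L * norm (u s - v s))"
      using lip[OF uX[OF that] vX[OF that]] by (rule mult_left_mono) simp
    also have "\<dots> = L * ((u s - v s) \<bullet> (u s - v s))"
      by (simp add: dot_square_norm power2_eq_square)
    finally show ?thesis
      unfolding g'_def by (simp add: mult_le_0_iff)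
  qed
  have "g t \<le> g 0"
  proof (rule DERIV_nonpos_imp_decreasing_open[OF \<open>t \<ge> 0\<close>])
    fix s assume "0 < s" "s < t"
    then have "(g has_real_derivative g' s) (at s)"
      using deriv[of s] at_within_interior[of s "{0..}"] by simp
    then show "\<exists>y. (g has_real_derivative y) (at s) \<and> y \<le> 0"
      using g'_nonpos[of s] \<open>0 < s\<close> by auto
  next
    have "continuous_on {0..} g"
      by (rule DERIV_continuous_on) (auto intro: deriv)
    then show "continuous_on {0..t} g"
      by (rule continuous_on_subset) auto
  qed
  have "norm (u t - v t) ^ 2 = exp (2 * (L * t)) * g t"
    unfolding g_def dot_square_norm by (simp add: exp_minus mult.assoc)
  also have "\<dots> \<le> exp (2 * (L * t)) * g 0"
    using \<open>g t \<le> g 0\<close> by simp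
  also have "\<dots> = (exp (L * t) * norm (u 0 - v 0)) ^ 2"
    unfolding g_def dot_square_norm exp_double power_mult_distrib by simp
  finally show ?thesis
    by (rule power2_le_imp_le) simp
qed

lemma forward_flow_separates_exponentially:
  assumes "forward_flow f \<phi>" and "forward_invariant \<phi> X"
    and "\<And>x y. x \<in> X \<Longrightarrow> y \<in> X \<Longrightarrow> norm (f x - f y) \<le> L * norm (x - y)"
    and "x \<in> X" "y \<in> X" "t \<ge> 0"
  shows "norm (\<phi> t x - \<phi> t y) \<le> exp (L * t) * norm (x - y)"
proof -
  have "norm (\<phi> t x - \<phi> t y) \<le> exp (L * t) * norm (\<phi> 0 x - \<phi> 0 y)"
    using assms unfolding forward_flow_def forward_invariant_def image_subset_iff
    by (intro solutions_separate_exponentially[where f = f and X = X]) auto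
  then show ?thesis
    using assms(1) by (simp add: forward_flow_def)
qed

lemma forward_flow_continuous_on:
  assumes "C1_vector_field f" "forward_flow f \<phi>" "compact X" "forward_invariant \<phi> X" "t \<ge> 0"
  shows "continuous_on X (\<phi> t)"
proof -
  obtain L where "\<And>x y. x \<in> X \<Longrightarrow> y \<in> X \<Longrightarrow> norm (f x - f y) \<le> L * norm (x - y)"
    using C1_vector_field_lipschitz_on_compact[OF assms(1,3)] by blast
  from forward_flow_separates_exponentially[OF assms(2,4) this _ _ assms(5)]
  have "(exp (L * t))-lipschitz_on X (\<phi> t)"
    by (auto simp: lipschitz_on_def dist_norm)
  then show ?thesis
    by (rule lipschitz_on_continuous_on)
qed

text \<open>
  The restarted curve \<open>\<tau> \<mapsto> \<phi> (\<tau> + s) x\<close> also solves the equation, from the initial value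
  \<open>\<phi> s x\<close>, and two solutions at distance \<open>0\<close> initially stay at distance \<open>0\<close>.
\<close>
lemma forward_flow_add:
  assumes "C1_vector_field f" "forward_flow f \<phi>" "compact X" "forward_invariant \<phi> X"
    and "x \<in> X" "s \<ge> 0" "t \<ge> 0"
  shows "\<phi> (t + s) x = \<phi> t (\<phi> s x)"
proof -
  obtain L where lip: "\<And>x y. x \<in> X \<Longrightarrow> y \<in> X \<Longrightarrow> norm (f x - f y) \<le> L * norm (x - y)"
    using C1_vector_field_lipschitz_on_compact[OF assms(1,3)] by blast
  have inX: "\<phi> \<tau> y \<in> X" if "y \<in> X" "\<tau> \<ge> 0" for \<tau> y
    using assms(4) that by (simp add: forward_invariant_def image_subset_iff)
  have sol: "((\<lambda>\<tau>. \<phi> \<tau> y) has_vector_derivative f (\<phi> \<tau> y)) (at \<tau> within {0..})"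
    if "\<tau> \<ge> 0" for \<tau> y
    using assms(2) that unfolding forward_flow_def by blast
  have restart:
    "((\<lambda>\<tau>. \<phi> (\<tau> + s) x) has_vector_derivative f (\<phi> (\<tau> + s) x)) (at \<tau> within {0..})"
    if "\<tau> \<ge> 0" for \<tau>
  proof -
    have shift: "((\<lambda>\<tau>. \<tau> + s) has_vector_derivative 1) (at \<tau> within {0..})"
      by (auto intro!: derivative_eq_intros)
    have "((\<lambda>\<tau>. \<phi> \<tau> x) has_vector_derivative f (\<phi> (\<tau> + s) x))
        (at (\<tau> + s) within (\<lambda>\<tau>. \<tau> + s) ` {0..})"
      using that \<open>s \<ge> 0\<close> by (intro has_vector_derivative_within_subset[OF sol]) auto
    from vector_diff_chain_within[OF shift this] show ?thesis
      by (simp add: o_def)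
  qed
  have "norm (\<phi> (t + s) x - \<phi> t (\<phi> s x)) \<le> exp (L * t) * norm (\<phi> (0 + s) x - \<phi> 0 (\<phi> s x))"
    using assms(5-7) by (intro solutions_separate_exponentially[OF lip restart sol]) (auto intro!: inX)
  also have "\<phi> 0 (\<phi> s x) = \<phi> s x"
    using assms(2) by (simp add: forward_flow_def)
  finally show ?thesis
    by simp
qed

theorem lemma3:
  fixes f :: "real ^ 'n \<Rightarrow> real ^ 'n"
    and \<phi> :: "real \<Rightarrow> real ^ 'n \<Rightarrow> real ^ 'n"
    and N :: "real ^ 'n \<Rightarrow> real"
    and X :: "(real ^ 'n) set"
  assumes "C1_vector_field f"
    and "forward_flow f \<phi>"
    and "is_norm N"
    and "compact X"
    and "forward_invariant \<phi> X"
    and "nonexpansive_on N \<phi> X"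
  shows "\<forall>x\<in>X. omega_limit \<phi> x \<subseteq> global_attractor \<phi> X"
proof
  fix x assume "x \<in> X"
  have "closure (\<Union>s\<in>{t..}. {\<phi> s x}) \<subseteq> \<phi> t ` X" if "t \<ge> 0" for t
  proof (rule closure_minimal)
    show "(\<Union>s\<in>{t..}. {\<phi> s x}) \<subseteq> \<phi> t ` X"
    proof clarsimp
      fix s assume "t \<le> s"
      then have "\<phi> s x = \<phi> t (\<phi> (s - t) x)"
        using forward_flow_add[OF assms(1,2,4,5) \<open>x \<in> X\<close>, of "s - t" t] that by simp
      moreover have "\<phi> (s - t) x \<in> X"
        using assms(5) \<open>x \<in> X\<close> \<open>t \<le> s\<close> by (simp add: forward_invariant_def image_subset_iff)
      ultimately show "\<phi> s x \<in> \<phi> t ` X"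
        by blast
    qed
    show "closed (\<phi> t ` X)"
      using forward_flow_continuous_on[OF assms(1,2,4,5) that] assms(4)
      by (intro compact_imp_closed compact_continuous_image)
  qed
  then show "omega_limit \<phi> x \<subseteq> global_attractor \<phi> X"
    unfolding omega_limit_def global_attractor_def by fastforce
qed

end
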